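(* Let $q$ be a prime power and let $n,k,t,r$ be integers with $0\le r<t$, $k\ge 2$ and $n=kt+r$. Then \[\rho_q(n,t)=q^{t+r}\sum_{i=0}^{k-2}q^{it}+1,\] and if furthermore $1\le r<t$, then \[\sigma_q(n,t)=q^{t+r}\sum_{i=0}^{k-2}q^{it}+q^{\lceil (t+r)/2\rceil}+1.\]
   Context: $V(n,q)$ denotes the $n$-dimensional vector space over the finite field with $q$ elements. A subspace partition of $V=V(n,q)$ is a collection $\Pi$ of subspaces of $V$ such that every $1$-dimensional subspace of $V$ is contained in exactly one member of $\Pi$; its size is the number of its subspaces, $|\Pi|$. $\sigma_q(n,t)$ denotes the minimum size of a subspace partition of $V(n,q)$ in which the largest subspace has dimension $t$, and $\rho_q(n,t)$ denotes the maximum size of a subspace partition of $V(n,q)$ in which the smallest subspace has dimension $t$. *)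

theory Defs
  imports Complex_Main "HOL-Library.Cardinality"
begin

text \<open>As in the literature, the zero subspace is not explicitly excluded from a partition.
  This is immaterial for the two extremal quantities below when \<open>t \<ge> 1\<close>: a smallest member of
  dimension \<open>t\<close> rules the zero subspace out, and removing it from a partition only lowers the size.\<close>

definition subspace_partition ::
    "('a::field \<Rightarrow> 'b::ab_group_add \<Rightarrow> 'b) \<Rightarrow> 'b set \<Rightarrow> 'b set set \<Rightarrow> bool" where
  "subspace_partition scale V P \<longleftrightarrow>
     (\<forall>U\<in>P. module.subspace scale U \<and> U \<subseteq> V) \<and>
     (\<forall>L. module.subspace scale L \<and> L \<subseteq> V \<and> vector_space.dim scale L = 1 \<longrightarrow>
        (\<exists>!U. U \<in> P \<and> L \<subseteq> U))"

text \<open>The set \<open>V\<close> is a subspace of the ambient type, playing the role of $V(n,q)$ when it has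
  dimension \<open>n\<close> and the scalar field has \<open>q\<close> elements; then \<open>V\<close> is a finite set, so the sets of
  sizes below are finite. The two quantities are $\sigma_q(n,t)$ and $\rho_q(n,t)$.\<close>

definition sigma_min :: "('a::field \<Rightarrow> 'b::ab_group_add \<Rightarrow> 'b) \<Rightarrow> 'b set \<Rightarrow> nat \<Rightarrow> nat" where
  "sigma_min scale V t = Min {card P | P. subspace_partition scale V P \<and>
     (\<exists>U\<in>P. vector_space.dim scale U = t) \<and> (\<forall>U\<in>P. vector_space.dim scale U \<le> t)}"

definition rho_max :: "('a::field \<Rightarrow> 'b::ab_group_add \<Rightarrow> 'b) \<Rightarrow> 'b set \<Rightarrow> nat \<Rightarrow> nat" where
  "rho_max scale V t = Max {card P | P. subspace_partition scale V P \<and>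
     (\<exists>U\<in>P. vector_space.dim scale U = t) \<and> (\<forall>U\<in>P. t \<le> vector_space.dim scale U)}"

end

theory Submission
  imports Defs "HOL-Algebra.Algebraic_Closure_Type"
begin

text \<open>
  Counting the nonzero vectors of \<open>V\<close> and of a hyperplane \<open>H\<close> shows that every partition \<open>P\<close>
  satisfies \<open>|P| = 1 + (\<Sum> |U|)\<close>, the sum being over the members \<open>U \<subseteq> H\<close>. Hence \<open>|P|\<close> is
  congruent to 1 modulo \<open>q^t\<close> if all members have dimension at least \<open>t\<close>, which together with
  \<open>|P| (q^t - 1) \<le> q^n - 1\<close> gives the upper bound for \<open>\<rho>\<close>.

  For the lower bound on \<open>\<sigma>\<close> put \<open>c = \<lceil>(t + r) / 2\<rceil>\<close>, \<open>s = q^(t + r) (\<Sum> q^(i t))\<close> and suppose that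
  \<open>\<delta> = |P| - 1 - s\<close> is smaller than \<open>q^c\<close>. Let \<open>T\<close> consist of the members of dimension less than
  \<open>c\<close>. Modulo \<open>q^c\<close> the identity reads \<open>(\<Sum> |U|) = \<delta>\<close>, the sum being over the \<open>U \<in> T\<close> inside \<open>H\<close>, so that
  this sum is at least \<open>\<delta>\<close> for every \<open>H\<close>. Its average over all linear functionals is \<open>|T|\<close>, whence
  \<open>|T| > \<delta>\<close>; but so many members of small dimension make \<open>|P|\<close> too large.

  Both bounds are attained by splitting \<open>V\<close> repeatedly into one large subspace \<open>W\<close> and \<open>|W|\<close>
  subspaces of dimension \<open>t\<close>, the latter cut out of the lines through the origin of a plane over the
  field with \<open>|W|\<close> elements.
\<close>

section \<open>Finite extensions of a finite field\<close>

text \<open>Multiplication by a nonzero \<open>x\<close> permutes the nonzero elements; comparing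
  their products gives \<open>x ^ (CARD('a) - 1) = 1\<close>.\<close>

lemma finite_field_power_card:
  fixes x :: "'a::{field,finite}"
  shows "x ^ CARD('a) = x"
proof (cases "x = 0")
  case False
  have "bij_betw ((*) x) (UNIV - {0}) (UNIV - {0})"
    by (rule bij_betw_byWitness[where f' = "\<lambda>y. y / x"]) (use False in auto)
  then have "(\<Prod>y\<in>UNIV - {0}. x * y) = \<Prod>(UNIV - {0})"
    by (rule prod.reindex_bij_betw)
  then have "x ^ (CARD('a) - 1) * \<Prod>(UNIV - {0}) = 1 * \<Prod>(UNIV - {0})"
    by (simp add: prod.distrib card_Diff_singleton)
  then have "x ^ (CARD('a) - 1) = 1"
    by (subst (asm) mult_cancel_right) simp
  moreover have "x ^ CARD('a) = x * x ^ (CARD('a) - 1)"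
    by (rule power_eq_if[THEN trans]) simp
  ultimately show ?thesis by simp
qed (simp add: finite_UNIV_card_ge_0)

text \<open>Translation by 1 permutes the field, so comparing the sums of all elements before and
  after leaves \<open>CARD('a)\<close> copies of 1 equal to 0.\<close>

lemma of_nat_CARD_eq_0: "of_nat CARD('a) = (0 :: 'a::{field,finite})"
proof -
  have "bij_betw ((+) 1) UNIV (UNIV :: 'a set)"
    by (rule bij_betw_byWitness[where f' = "\<lambda>y. y - 1"]) auto
  then have "(\<Sum>x\<in>UNIV. 1 + x) = (\<Sum>x\<in>UNIV. x :: 'a)"
    by (rule sum.reindex_bij_betw)
  then show ?thesis by (simp add: sum.distrib)
qed

text \<open>\<open>(x + y)^q - x^q - y^q\<close> has degree less than \<open>q\<close> in either variable, so it suffices to let both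
  range over the \<open>q\<close> elements of the base field.\<close>

lemma alg_closure_power_CARD_add:
  fixes x y :: "'a::{field,finite} alg_closure"
  shows "(x + y) ^ CARD('a) = x ^ CARD('a) + y ^ CARD('a)"
proof -
  let ?q = "CARD('a)"
  have q: "?q > 0" by (simp add: finite_UNIV_card_ge_0)
  define P where "P x = [:x, 1:] ^ ?q - monom 1 ?q - [:x ^ ?q:]" for x :: "'a alg_closure"
  have poly_P: "poly (P x) y = (x + y) ^ ?q - y ^ ?q - x ^ ?q" for x y
    by (simp add: P_def poly_monom)
  have deg: "degree (P x) < ?q" for x
  proof -
    have "degree (P x) \<le> ?q"
      unfolding P_def by (intro degree_diff_le) (auto simp: degree_linear_power degree_monom_le)
    moreover have "coeff ([:x, 1:] ^ ?q) ?q = 1"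
      using lead_coeff_power[of "[:x, 1:]" ?q] by (simp add: degree_linear_power)
    then have "coeff (P x) ?q = 0"
      using q by (cases ?q) (auto simp: P_def)
    ultimately show ?thesis
      using q by (metis degree_0 le_neq_implies_less leading_coeff_0_iff)
  qed
  have vanish: "P x = 0" if "\<And>a. poly (P x) (to_ac a) = 0" for x
  proof (rule ccontr)
    assume "P x \<noteq> 0"
    then have "card {z. poly (P x) z = 0} \<le> degree (P x)" "finite {z. poly (P x) z = 0}"
      by (auto intro: card_poly_roots_bound poly_roots_finite)
    moreover have "card (range (to_ac :: 'a \<Rightarrow> _)) = ?q"
      by (simp add: card_image inj_to_ac)
    moreover have "range to_ac \<subseteq> {z. poly (P x) z = 0}"
      using that by auto
    ultimately show False
      using deg[of x] card_mono[of "{z. poly (P x) z = 0}" "range to_ac"] by linarith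
  qed
  have "P (to_ac a) = 0" for a
  proof (rule vanish)
    fix b
    have "(to_ac a + to_ac b) ^ ?q = to_ac ((a + b) ^ ?q)" by (simp only: to_ac_add to_ac_power)
    also have "\<dots> = to_ac a + to_ac b" by (simp only: finite_field_power_card to_ac_add)
    finally show "poly (P (to_ac a)) (to_ac b) = 0"
      by (simp add: poly_P finite_field_power_card del: to_ac_power flip: to_ac_power)
  qed
  \<comment> \<open>The difference is symmetric in its two arguments, so evaluating
    \<open>P (to_ac a) = 0\<close> at \<open>x\<close> makes every \<open>to_ac a\<close> a root of
    \<open>P x\<close>.\<close>
  then have "poly (P x) (to_ac a) = 0" for a
    using poly_P[of "to_ac a" x] by (simp add: poly_P diff_eq_eq add.commute)
  then have "P x = 0" by (rule vanish)
  then show ?thesis using poly_P[of x y] by (simp only: poly_0 diff_diff_add right_minus_eq add.commute eq_commute[of 0])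
qed

lemma alg_closure_power_CARD_power_add:
  fixes x y :: "'a::{field,finite} alg_closure"
  shows "(x + y) ^ (CARD('a) ^ m) = x ^ (CARD('a) ^ m) + y ^ (CARD('a) ^ m)"
proof (induction m)
  case (Suc m)
  then show ?case
    by (simp only: power_Suc2 power_mult alg_closure_power_CARD_add)
qed simp

lemma finite_field_power_CARD_power:
  fixes x :: "'a::{field,finite}"
  shows "x ^ (CARD('a) ^ m) = x"
  by (induction m) (simp_all add: power_mult finite_field_power_card)

text \<open>The fixed points of the \<open>m\<close>-th iterate of the Frobenius map: for
  \<open>m > 0\<close> the field with \<open>CARD('a) ^ m\<close> elements. For \<open>m = 0\<close>
  the condition is vacuous and the set is the whole closure.\<close>

definition subfield_of_degree :: "nat \<Rightarrow> 'a::{field,finite} alg_closure set" where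
  "subfield_of_degree m = {x. x ^ (CARD('a) ^ m) = x}"

text \<open>\<open>X^Q - X\<close> splits over the algebraic closure and its derivative is
  \<open>-1\<close>, so its \<open>Q\<close> roots are distinct.\<close>

lemma card_subfield_of_degree:
  assumes "m > 0"
  shows "card (subfield_of_degree m :: 'a::{field,finite} alg_closure set) = CARD('a) ^ m"
proof -
  let ?Q = "CARD('a) ^ m"
  have "card {0, 1 :: 'a} \<le> CARD('a)" by (intro card_mono) auto
  then have "CARD('a) > 1" by simp
  then have Q: "?Q > 1" using assms one_less_power by blast
  define p :: "'a alg_closure poly" where "p = monom 1 ?Q - [:0, 1:]"
  have deg: "degree p = ?Q"
    unfolding p_def diff_conv_add_uminus using Q
    by (subst degree_add_eq_left) (auto simp: degree_monom_eq)
  have "of_nat CARD('a) = (0 :: 'a alg_closure)"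
    using of_nat_CARD_eq_0[where 'a = 'a] by (metis to_ac_0 to_ac_of_nat)
  \<comment> \<open>The derivative of \<open>X^Q\<close> is \<open>Q X^(Q - 1)\<close>, and
    \<open>Q\<close> is a multiple of \<open>CARD('a)\<close> because \<open>m > 0\<close>.\<close>
  then have "pderiv p = -1"
    using assms by (simp add: p_def pderiv_diff pderiv_monom pderiv_pCons one_pCons power_0_left)
  have p0: "p \<noteq> 0" using deg Q by auto
  obtain A where A: "size A = degree p" "p = smult (lead_coeff p) (\<Prod>x\<in>#A. [:-x, 1:])"
    using alg_closed_imp_factorization[OF p0] by blast
  have "proots p = proots (\<Prod>x\<in>#A. [:-x, 1:])"
    using A(2) p0 by (metis leading_coeff_0_iff proots_smult)
  also have "\<dots> = A"
  proof (induction A)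
    case (add x A)
    have "(\<Prod>x\<in>#A. [:-x, 1:]) \<noteq> 0" by auto
    with add show ?case by (simp add: proots_mult del: mult_pCons_left)
  qed simp
  finally have size: "size (proots p) = ?Q"
    using A(1) deg by simp
  have "\<not> 2 \<le> order x p" for x
  proof
    assume "2 \<le> order x p"
    then have "[:-x, 1:] ^ 2 dvd p" by (simp add: order_divides)
    then obtain s where "p = [:-x, 1:] ^ 2 * s" by (rule dvdE)
    then have "p = [:-x, 1:] * ([:-x, 1:] * s)"
      by (simp only: power2_eq_square mult.assoc)
    then have "poly (pderiv p) x = 0"
      by (simp add: pderiv_mult del: mult_pCons_left)
    then show False using \<open>pderiv p = -1\<close> by simp
  qed
  moreover have "order x p \<noteq> 0" if "x \<in># proots p" for x
    using p0 that by (simp add: order_root)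
  ultimately have "order x p = 1" if "x \<in># proots p" for x
    using that by (metis One_nat_def Suc_1 Suc_leI le_neq_implies_less not_less_eq_eq zero_less_iff_neq_zero)
  then have "count (proots p) x = 1" if "x \<in># proots p" for x
    using p0 that by simp
  then have "size (proots p) = card (set_mset (proots p))"
    by (simp add: size_multiset_overloaded_eq)
  also have "set_mset (proots p) = subfield_of_degree m"
    using p0 by (auto simp: subfield_of_degree_def p_def poly_monom)
  finally show ?thesis using size by simp
qed

lemma subfield_of_degree_add:
  "x \<in> subfield_of_degree m \<Longrightarrow> y \<in> subfield_of_degree m \<Longrightarrow> x + y \<in> subfield_of_degree m"
  by (simp add: subfield_of_degree_def alg_closure_power_CARD_power_add)

lemma subfield_of_degree_mult:
  "x \<in> subfield_of_degree m \<Longrightarrow> y \<in> subfield_of_degree m \<Longrightarrow> x * y \<in> subfield_of_degree m"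
  by (simp add: subfield_of_degree_def power_mult_distrib)

lemma subfield_of_degree_divide:
  "x \<in> subfield_of_degree m \<Longrightarrow> y \<in> subfield_of_degree m \<Longrightarrow> x / y \<in> subfield_of_degree m"
  by (simp add: subfield_of_degree_def power_divide)

lemma zero_in_subfield_of_degree: "0 \<in> subfield_of_degree m"
  by (simp add: subfield_of_degree_def power_0_left)

lemma to_ac_in_subfield_of_degree: "to_ac a \<in> subfield_of_degree m"
  by (simp add: subfield_of_degree_def finite_field_power_CARD_power del: to_ac_power flip: to_ac_power)

section \<open>Vector spaces over a finite field\<close>

lemma CARD_field_gt_1: "CARD('a::{field,finite}) > 1"
proof -
  have "card {0, 1 :: 'a} \<le> CARD('a)" by (intro card_mono) auto
  then show ?thesis by simp
qed

locale finite_field_vector_space = vector_space scale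
  for scale :: "'a::{field,finite} \<Rightarrow> 'b::ab_group_add \<Rightarrow> 'b" (infixr \<open>*s\<close> 75)
    and q :: nat +
  assumes card_field: "CARD('a) = q"
begin

lemma q_gt_1: "q > 1"
  using CARD_field_gt_1[where 'a = 'a] by (simp add: card_field)

lemma card_span_insert:
  assumes "finite (span B)" "b \<notin> span B"
  shows "finite (span (insert b B))" "card (span (insert b B)) = q * card (span B)"
proof -
  have bij: "bij_betw (\<lambda>(c, u). c *s b + u) (UNIV \<times> span B) (span (insert b B))"
    unfolding bij_betw_def
  proof
    show "inj_on (\<lambda>(c, u). c *s b + u) (UNIV \<times> span B)"
    proof (rule inj_onI, clarsimp)
      fix c u c' u'
      assume *: "u \<in> span B" "u' \<in> span B" "c *s b + u = c' *s b + u'"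
      then have eq: "(c - c') *s b = u' - u"
        by (simp add: scale_left_diff_distrib algebra_simps)
      then have "(c - c') *s b \<in> span B" using * by (simp add: span_diff)
      then have "inverse (c - c') *s (c - c') *s b \<in> span B" by (rule span_scale)
      then have "c = c'" using assms(2) by (cases "c = c'") auto
      with eq show "c = c' \<and> u = u'" by simp
    qed
    show "(\<lambda>(c, u). c *s b + u) ` (UNIV \<times> span B) = span (insert b B)"
    proof (intro equalityI subsetI)
      fix x assume "x \<in> span (insert b B)"
      then obtain k where "x - k *s b \<in> span B" by (auto simp: span_insert)
      then show "x \<in> (\<lambda>(c, u). c *s b + u) ` (UNIV \<times> span B)"
        by (intro image_eqI[of _ _ "(k, x - k *s b)"]) auto
    next
      fix x assume "x \<in> (\<lambda>(c, u). c *s b + u) ` (UNIV \<times> span B)"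
      then obtain c u where "x = c *s b + u" "u \<in> span B" by auto
      then show "x \<in> span (insert b B)" by (auto simp: span_insert intro!: exI[of _ c])
    qed
  qed
  have "finite (UNIV \<times> span B :: ('a \<times> 'b) set)" using assms by simp
  then show "finite (span (insert b B))" using bij_betw_finite[OF bij] by simp
  show "card (span (insert b B)) = q * card (span B)"
    using bij_betw_same_card[OF bij] by (simp add: card_cartesian_product card_field)
qed

lemma finite_card_span_independent:
  assumes "finite B" "independent B"
  shows "finite (span B) \<and> card (span B) = q ^ card B"
  using assms
proof (induction B rule: finite_induct)
  case (insert b B)
  then have "independent B" "b \<notin> span B" by (auto simp: independent_insert)
  with insert card_span_insert[of B b] show ?case by simp
qed simp

lemma card_subspace:
  assumes "subspace U" "finite U"
  shows "card U = q ^ dim U"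
proof -
  obtain B where B: "B \<subseteq> U" "independent B" "U \<subseteq> span B" "card B = dim U"
    by (rule basis_exists)
  moreover have "span B = U" using B assms span_subspace by blast
  moreover have "finite B" using B assms finite_subset by blast
  ultimately show ?thesis using finite_card_span_independent by fastforce
qed

text \<open>The ambient space may be infinite-dimensional, and \<open>dim\<close> is 0 for subspaces
  without a finite basis; a positive \<open>dim\<close> therefore guarantees a finite basis, hence
  finitely many vectors.\<close>

lemma finite_subspace:
  assumes "subspace U" "dim U > 0"
  shows "finite U"
proof -
  obtain B where B: "B \<subseteq> U" "independent B" "U \<subseteq> span B" "card B = dim U"
    by (rule basis_exists)
  moreover have "span B = U" using B assms span_subspace by blast
  moreover have "finite B" using B assms by (metis card.infinite less_irrefl)
  ultimately show ?thesis using finite_card_span_independent by fastforce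
qed

text \<open>\<open>U\<close> is the direct sum of the line through \<open>u\<close> and the kernel.
  Linearity is asked for on \<open>U\<close> only, since the bilinear form below is only assumed
  linear on \<open>V\<close>.\<close>

lemma card_kernel:
  fixes f :: "'b \<Rightarrow> 'a"
  assumes U: "subspace U" "finite U"
    and add: "\<And>x y. x \<in> U \<Longrightarrow> y \<in> U \<Longrightarrow> f (x + y) = f x + f y"
    and scale: "\<And>c x. x \<in> U \<Longrightarrow> f (c *s x) = c * f x"
    and u: "u \<in> U" "f u \<noteq> 0"
  shows "q * card {x \<in> U. f x = 0} = card U"
proof -
  define K where "K = {x \<in> U. f x = 0}"
  have "bij_betw (\<lambda>(c, x). c *s u + x) (UNIV \<times> K) U"
  proof (rule bij_betw_byWitness[where f' = "\<lambda>x. (f x / f u, x - (f x / f u) *s u)"])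
    have diff: "f (x - c *s u) = f x - c * f u" if "x \<in> U" for x c
      using add[OF that subspace_scale[OF U(1) u(1)], of "-c"] scale[OF u(1), of "-c"] by simp
    show "\<forall>a\<in>UNIV \<times> K. (f ((\<lambda>(c, x). c *s u + x) a) / f u,
        (\<lambda>(c, x). c *s u + x) a - (f ((\<lambda>(c, x). c *s u + x) a) / f u) *s u) = a"
      using U u by (auto simp: K_def add scale subspace_scale)
    show "(\<lambda>x. (f x / f u, x - (f x / f u) *s u)) ` U \<subseteq> UNIV \<times> K"
      using U u by (auto simp: K_def diff subspace_scale subspace_diff)
  qed (use U u in \<open>auto simp: K_def subspace_add subspace_scale\<close>)
  then show ?thesis
    using bij_betw_same_card by (fastforce simp: K_def card_cartesian_product card_field)
qed

end

text \<open>The form identifies \<open>V\<close> with its dual space: the hyperplanes are the kernels of \<open>\<lambda>x. \<beta> x y\<close>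
  for nonzero \<open>y \<in> V\<close>.\<close>

locale nondegenerate_form = finite_field_vector_space scale q
  for scale :: "'a::{field,finite} \<Rightarrow> 'b::ab_group_add \<Rightarrow> 'b" (infixr \<open>*s\<close> 75)
    and q :: nat +
  fixes V :: "'b set" and \<beta> :: "'b \<Rightarrow> 'b \<Rightarrow> 'a"
  assumes subspace_V: "subspace V" and finite_V: "finite V"
    and sym: "\<beta> x y = \<beta> y x"
    and form_add: "x \<in> V \<Longrightarrow> y \<in> V \<Longrightarrow> \<beta> (x + y) z = \<beta> x z + \<beta> y z"
    and form_scale: "x \<in> V \<Longrightarrow> \<beta> (c *s x) z = c * \<beta> x z"
    and nondegenerate: "x \<in> V \<Longrightarrow> x \<noteq> 0 \<Longrightarrow> \<exists>y\<in>V. \<beta> x y \<noteq> 0"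
begin

lemma card_perp:
  assumes "subspace U" "U \<subseteq> V" "u \<in> U" "\<beta> u y \<noteq> 0"
  shows "q * card {x \<in> U. \<beta> x y = 0} = card U"
  using assms finite_subset[OF assms(2) finite_V]
  by (intro card_kernel) (auto simp: form_add form_scale subset_iff)

text \<open>Double counting of the orthogonal pairs in \<open>U \<times> V\<close>: a nonzero
  \<open>u\<close> is orthogonal to one \<open>q\<close>-th of \<open>V\<close>, and a
  \<open>y\<close> outside the annihilator to one \<open>q\<close>-th of \<open>U\<close>. The
  counts are multiplied by \<open>q\<close> to avoid division.\<close>

lemma card_annihilator:
  assumes U: "subspace U" "U \<subseteq> V"
  shows "card U * card {y \<in> V. \<forall>u\<in>U. \<beta> u y = 0} = card V"
proof -
  have fin: "finite U" using U finite_V finite_subset by blast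
  define A where "A = {y \<in> V. \<forall>u\<in>U. \<beta> u y = 0}"
  have A: "finite A" "A \<subseteq> V" using finite_V by (auto simp: A_def)
  have zero: "\<beta> 0 y = 0" for y
    using form_scale[of 0 0 y] subspace_0[OF subspace_V] by simp
  have "(\<Sum>u\<in>U. q * card {y \<in> V. \<beta> u y = 0}) = q * card V + (\<Sum>u\<in>U - {0}. card V)"
  proof -
    have "q * card {y \<in> V. \<beta> u y = 0} = card V" if u: "u \<in> U - {0}" for u
    proof -
      obtain y where "y \<in> V" "\<beta> u y \<noteq> 0"
        using u U nondegenerate[of u] by blast
      then have "q * card {x \<in> V. \<beta> x u = 0} = card V"
        using card_perp[OF subspace_V order.refl, of y u] sym[of y u] by simp
      moreover have "{x \<in> V. \<beta> x u = 0} = {x \<in> V. \<beta> u x = 0}"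
        by (rule Collect_cong) (simp only: sym[of _ u])
      ultimately show ?thesis by simp
    qed
    then have "(\<Sum>u\<in>U - {0}. q * card {y \<in> V. \<beta> u y = 0}) = (\<Sum>u\<in>U - {0}. card V)"
      by (rule sum.cong[OF refl])
    moreover have "{y \<in> V. \<beta> 0 y = 0} = V" by (simp add: zero)
    ultimately show ?thesis
      using fin subspace_0[OF U(1)] by (simp only: sum.remove[of U 0])
  qed
  also have "\<dots> = (q - 1) * card V + card U * card V"
  proof -
    have "card U * card V = Suc (card (U - {0})) * card V"
      using fin subspace_0[OF U(1)] by (simp only: card_Suc_Diff1)
    moreover obtain p where "q = Suc p" using q_gt_1 by (cases q) auto
    ultimately show ?thesis by (simp only: sum_constant of_nat_id) simp
  qed
  finally have 1: "(\<Sum>u\<in>U. q * card {y \<in> V. \<beta> u y = 0}) = (q - 1) * card V + card U * card V" .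
  \<comment> \<open>The same pairs are now counted by their second component.\<close>
  have "(\<Sum>u\<in>U. card {y \<in> V. \<beta> u y = 0}) = (\<Sum>u\<in>U. \<Sum>y\<in>V. if \<beta> u y = 0 then 1 else 0)"
    using finite_V by (simp only: card_eq_sum sum.inter_filter)
  also have "\<dots> = (\<Sum>y\<in>V. \<Sum>u\<in>U. if \<beta> u y = 0 then 1 else 0)"
    by (rule sum.swap)
  also have "\<dots> = (\<Sum>y\<in>V. card {u \<in> U. \<beta> u y = 0})"
    using fin by (simp only: card_eq_sum sum.inter_filter)
  finally have "(\<Sum>u\<in>U. card {y \<in> V. \<beta> u y = 0}) = (\<Sum>y\<in>V. card {u \<in> U. \<beta> u y = 0})" .
  then have "(\<Sum>u\<in>U. q * card {y \<in> V. \<beta> u y = 0}) = (\<Sum>y\<in>V. q * card {u \<in> U. \<beta> u y = 0})"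
    by (simp flip: sum_distrib_left)
  also have "\<dots> = (\<Sum>y\<in>A. q * card U) + (\<Sum>y\<in>V - A. card U)"
  proof -
    have "q * card {u \<in> U. \<beta> u y = 0} = card U" if "y \<in> V - A" for y
      using that card_perp[OF U] by (auto simp: A_def)
    moreover have "{u \<in> U. \<beta> u y = 0} = U" if "y \<in> A" for y
      using that by (auto simp: A_def)
    ultimately show ?thesis
      unfolding sum.subset_diff[OF A(2) finite_V] by (simp only: add.commute cong: sum.cong)
  qed
  also have "\<dots> = (q - 1) * (card A * card U) + card V * card U"
  proof -
    obtain p where "q = Suc p" using q_gt_1 by (cases q) auto
    moreover have "card V * card U = (card A + card (V - A)) * card U"
      using A finite_V by (simp add: card_Diff_subset card_mono)
    ultimately show ?thesis by (simp only: sum_constant of_nat_id) (simp add: algebra_simps del: card_Diff_subset)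
  qed
  finally have "(q - 1) * card V = (q - 1) * (card A * card U)"
    using 1 by (simp add: mult.commute)
  then show ?thesis
    using q_gt_1 by (simp add: A_def mult.commute)
qed

end

text \<open>The dot product of coordinate vectors in a basis of \<open>V\<close>; it is
  nondegenerate because pairing \<open>x\<close> with a basis vector returns a coordinate of
  \<open>x\<close>.\<close>

lemma (in finite_field_vector_space) nondegenerate_form_exists:
  assumes "subspace V" "finite V"
  obtains \<beta> where "nondegenerate_form scale q V \<beta>"
proof -
  obtain B where B: "B \<subseteq> V" "independent B" "V \<subseteq> span B"
    by (rule basis_exists)
  then have fin: "finite B" "span B = V" using assms finite_subset span_subspace by blast+
  define \<beta> where "\<beta> x y = (\<Sum>b\<in>B. representation B x b * representation B y b)" for x y
  have "nondegenerate_form scale q V \<beta>"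
  proof unfold_locales
    fix x y z c
    show "\<beta> x y = \<beta> y x" by (simp add: \<beta>_def mult.commute)
    show "\<beta> (x + y) z = \<beta> x z + \<beta> y z" if "x \<in> V" "y \<in> V"
      using that B fin by (simp add: \<beta>_def representation_add distrib_right sum.distrib)
    show "\<beta> (c *s x) z = c * \<beta> x z" if "x \<in> V"
      using that B fin by (simp add: \<beta>_def representation_scale sum_distrib_left mult.assoc)
    show "\<exists>y\<in>V. \<beta> x y \<noteq> 0" if x: "x \<in> V" "x \<noteq> 0"
    proof -
      have "(\<Sum>b\<in>B. representation B x b *s b) = x"
        using B fin x by (intro sum_representation_eq) auto
      then obtain b where b: "b \<in> B" "representation B x b \<noteq> 0"
        using x(2) by (metis (no_types, lifting) scale_zero_left sum.neutral)
      then have "\<beta> x b = (\<Sum>b'\<in>B. if b' = b then representation B x b' else 0)"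
        using B by (auto simp: \<beta>_def representation_basis intro!: sum.cong)
      then have "\<beta> x b \<noteq> 0" using b fin by simp
      then show ?thesis using b B by auto
    qed
  qed (use assms in auto)
  then show ?thesis by (rule that)
qed

section \<open>The hyperplane identity\<close>

text \<open>A line lies in a subspace exactly when its generator does, so a partition can be tested
  on nonzero vectors, the form suited to counting.\<close>

lemma (in finite_field_vector_space) subspace_partition_iff:
  "subspace_partition scale V P \<longleftrightarrow>
    (\<forall>U\<in>P. subspace U \<and> U \<subseteq> V) \<and> (\<forall>v\<in>V - {0}. \<exists>!U. U \<in> P \<and> v \<in> U)"
  if V: "subspace V"
proof (intro iffI conjI ballI)
  assume P: "subspace_partition scale V P"
  then show sub: "subspace U" "U \<subseteq> V" if "U \<in> P" for U
    using that by (auto simp: subspace_partition_def)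
  fix v assume v: "v \<in> V - {0}"
  then have "span {v} \<subseteq> V" using V by (intro span_minimal) auto
  moreover have "dim (span {v}) = 1"
    using v by (subst dim_span_eq_card_independent) auto
  ultimately have "\<exists>!U. U \<in> P \<and> span {v} \<subseteq> U"
    using P by (auto simp: subspace_partition_def)
  moreover have "span {v} \<subseteq> U \<longleftrightarrow> v \<in> U" if "U \<in> P" for U
    using sub(1)[OF that] span_minimal[of "{v}" U] span_base[of v "{v}"] by auto
  ultimately show "\<exists>!U. U \<in> P \<and> v \<in> U"
    by metis
next
  assume P: "(\<forall>U\<in>P. subspace U \<and> U \<subseteq> V) \<and> (\<forall>v\<in>V - {0}. \<exists>!U. U \<in> P \<and> v \<in> U)"
  have "\<exists>!U. U \<in> P \<and> L \<subseteq> U" if L: "subspace L" "L \<subseteq> V" "dim L = 1" for L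
  proof -
    obtain B where B: "B \<subseteq> L" "independent B" "L \<subseteq> span B" "card B = dim L"
      by (rule basis_exists)
    then obtain v where v: "B = {v}" using L card_1_singletonE by metis
    have eq: "L = span {v}" using B L v span_subspace by metis
    have v': "v \<in> V - {0}" using B L v by auto
    then have "\<exists>!U. U \<in> P \<and> v \<in> U" using P by blast
    moreover have "L \<subseteq> U \<longleftrightarrow> v \<in> U" if "U \<in> P" for U
      using P that span_minimal[of "{v}" U] span_base[of v "{v}"] by (auto simp: eq)
    ultimately show ?thesis by metis
  qed
  with P show "subspace_partition scale V P"
    by (auto simp: subspace_partition_def)
qed

context finite_field_vector_space
begin

lemma finite_subspace_partition:
  assumes "subspace_partition scale V P" "finite V"
  shows "finite P"
  using assms by (auto simp: subspace_partition_def intro: finite_subset[of P "Pow V"])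

text \<open>The nonzero vectors of \<open>S\<close> are counted once each, while 0 lies in every
  member. Allowing any \<open>S\<close> with \<open>0 \<in> S\<close> covers both \<open>V\<close>
  and its hyperplanes.\<close>

lemma sum_card_Int_partition:
  assumes V: "subspace V" "finite V" and P: "subspace_partition scale V P"
    and S: "S \<subseteq> V" "0 \<in> S"
  shows "(\<Sum>U\<in>P. card (U \<inter> S)) + 1 = card S + card P"
proof -
  note P' = P[unfolded subspace_partition_iff[OF V(1)]]
  have fin: "finite P" "finite S"
    using finite_subspace_partition[OF P V(2)] finite_subset[OF S(1) V(2)] by auto
  have "card (U \<inter> S) = card (U \<inter> S - {0}) + 1" if "U \<in> P" for U
  proof -
    have "0 \<in> U \<inter> S" using P' that S subspace_0 by auto
    then show ?thesis using fin card_Suc_Diff1[of "U \<inter> S" 0] by simp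
  qed
  then have "(\<Sum>U\<in>P. card (U \<inter> S)) = (\<Sum>U\<in>P. card (U \<inter> S - {0}) + 1)"
    by (rule sum.cong[OF refl])
  also have "\<dots> = (\<Sum>U\<in>P. card (U \<inter> S - {0})) + card P"
    by (simp only: sum.distrib card_eq_sum)
  also have "(\<Sum>U\<in>P. card (U \<inter> S - {0})) = card (\<Union>U\<in>P. U \<inter> S - {0})"
    using fin P' S by (intro card_UN_disjoint[symmetric]) (simp, simp, blast)
  also have "(\<Union>U\<in>P. U \<inter> S - {0}) = S - {0}"
    using P' S by blast
  finally show ?thesis
    using card_Suc_Diff1[OF fin(2) S(2)] by simp
qed

lemma sum_card_partition:
  assumes V: "subspace V" "finite V" and P: "subspace_partition scale V P"
  shows "(\<Sum>U\<in>P. card U) + 1 = card V + card P"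
proof -
  have "(\<Sum>U\<in>P. card (U \<inter> V)) = (\<Sum>U\<in>P. card U)"
    using P by (intro sum.cong) (auto simp: subspace_partition_def Int_absorb2)
  then show ?thesis
    using sum_card_Int_partition[OF assms order.refl] subspace_0[OF V(1)] by simp
qed

end

section \<open>Members contained in a hyperplane, and their average over the dual space\<close>

context nondegenerate_form
begin

text \<open>For \<open>U \<subseteq> V\<close> and nonzero \<open>y \<in> V\<close> this is
  containment in the hyperplane dual to \<open>y\<close>; for \<open>y = 0\<close> it always
  holds.\<close>

definition perp :: "'b set \<Rightarrow> 'b \<Rightarrow> bool" where
  "perp U y \<longleftrightarrow> (\<forall>u\<in>U. \<beta> u y = 0)"

text \<open>Vectors are counted in \<open>V\<close> and in the hyperplane \<open>H\<close> dual to
  \<open>y\<close>; as \<open>card V = q * card H\<close>, the size of \<open>V\<close> cancels when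
  the first count is subtracted from \<open>q\<close> times the second.\<close>

lemma card_partition_eq_sum_perp:
  assumes P: "subspace_partition scale V P" and y: "y \<in> V" "y \<noteq> 0"
  shows "card P = 1 + (\<Sum>U | U \<in> P \<and> perp U y. card U)"
proof -
  note P' = P[unfolded subspace_partition_iff[OF subspace_V]]
  have fin: "finite P" using finite_subspace_partition[OF P finite_V] .
  define H where "H = {x \<in> V. \<beta> x y = 0}"
  define F where "F = (\<Sum>U | U \<in> P \<and> perp U y. card U)"
  obtain p where p: "q = Suc p" "p > 0" using q_gt_1 by (cases q) auto
  obtain z where "z \<in> V" "\<beta> z y \<noteq> 0"
    using nondegenerate[OF y] sym[of y] by auto
  then have H: "q * card H = card V"
    unfolding H_def by (intro card_perp[OF subspace_V]) auto
  have "\<beta> 0 y = 0"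
    using form_scale[of 0 0 y] subspace_0[OF subspace_V] by simp
  then have "0 \<in> H" using subspace_0[OF subspace_V] by (simp add: H_def)
  then have 1: "(\<Sum>U\<in>P. card (U \<inter> H)) + 1 = card H + card P"
    by (intro sum_card_Int_partition[OF subspace_V finite_V P]) (auto simp: H_def)
  have 2: "(\<Sum>U\<in>P. card U) + 1 = card V + card P"
    by (rule sum_card_partition[OF subspace_V finite_V P])
  \<comment> \<open>A member inside \<open>H\<close> loses nothing on intersecting; any other member
    shrinks by the factor \<open>q\<close>.\<close>
  have "q * card (U \<inter> H) = card U + p * (if perp U y then card U else 0)" if "U \<in> P" for U
  proof -
    have U: "subspace U" "U \<subseteq> V" using P' that by auto
    show ?thesis
    proof (cases "perp U y")
      case True
      then have "U \<inter> H = U" using U by (auto simp: perp_def H_def)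
      with True p show ?thesis by simp
    next
      case False
      moreover have "U \<inter> H = {x \<in> U. \<beta> x y = 0}" using U by (auto simp: H_def)
      ultimately show ?thesis using card_perp[OF U, of _ y] by (auto simp: perp_def)
    qed
  qed
  then have "(\<Sum>U\<in>P. q * card (U \<inter> H)) = (\<Sum>U\<in>P. card U + p * (if perp U y then card U else 0))"
    by (rule sum.cong[OF refl])
  also have "\<dots> = (\<Sum>U\<in>P. card U) + p * F"
    using fin by (simp only: sum.distrib sum_distrib_left[symmetric] sum.inter_filter F_def)
  finally have "q * (\<Sum>U\<in>P. card (U \<inter> H)) = (\<Sum>U\<in>P. card U) + p * F"
    by (simp only: sum_distrib_left)
  moreover have "q * (\<Sum>U\<in>P. card (U \<inter> H)) + q = card V + q * card P"
    using arg_cong[OF 1, of "\<lambda>x. q * x"] H by (simp add: distrib_left)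
  ultimately have "p * card P = p * (1 + F)"
    using 2 by (simp add: p(1))
  then have "card P = 1 + F" by (simp only: nat_mult_eq_cancel1[OF p(2)])
  then show ?thesis by (simp only: F_def)
qed

text \<open>After swapping the sums, each \<open>U\<close> contributes \<open>card U\<close> once
  for every \<open>y\<close> in its annihilator, that is \<open>card V\<close> in total.\<close>

lemma sum_perp_average:
  assumes T: "\<And>U. U \<in> T \<Longrightarrow> subspace U \<and> U \<subseteq> V"
  shows "(\<Sum>y\<in>V. \<Sum>U | U \<in> T \<and> perp U y. card U) = card T * card V"
proof -
  have fin: "finite T" using T finite_V by (auto intro: finite_subset[of T "Pow V"])
  have "(\<Sum>y\<in>V. \<Sum>U | U \<in> T \<and> perp U y. card U) = (\<Sum>y\<in>V. \<Sum>U\<in>T. if perp U y then card U else 0)"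
    using fin by (simp only: sum.inter_filter)
  also have "\<dots> = (\<Sum>U\<in>T. \<Sum>y\<in>V. if perp U y then card U else 0)"
    by (rule sum.swap)
  also have "\<dots> = (\<Sum>U\<in>T. \<Sum>y\<in>{y \<in> V. perp U y}. card U)"
    using finite_V by (simp only: sum.inter_filter)
  also have "\<dots> = (\<Sum>U\<in>T. card V)"
  proof (rule sum.cong[OF refl])
    fix U assume "U \<in> T"
    then show "(\<Sum>y\<in>{y \<in> V. perp U y}. card U) = card V"
      using card_annihilator[of U] T by (simp add: perp_def mult.commute)
  qed
  finally show ?thesis by simp
qed

text \<open>Averaging the lower bound gives \<open>card T \<ge> \<delta>\<close>; strictness comes
  from the term \<open>y = 0\<close>, whose value \<open>D\<close> is at least
  \<open>2 * card T\<close> because every member contains a nonzero vector.\<close>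

lemma card_gt_of_sum_perp_ge:
  assumes T: "\<And>U. U \<in> T \<Longrightarrow> subspace U \<and> U \<subseteq> V \<and> U \<noteq> {0}"
    and V: "V \<noteq> {0}" and \<delta>: "\<delta> > 0"
    and ge: "\<And>y. y \<in> V \<Longrightarrow> y \<noteq> 0 \<Longrightarrow> \<delta> \<le> (\<Sum>U | U \<in> T \<and> perp U y. card U)"
  shows "card T > \<delta>"
proof (rule ccontr)
  assume "\<not> card T > \<delta>"
  then have le: "card T \<le> \<delta>" by simp
  define D where "D = (\<Sum>U\<in>T. card U)"
  have V0: "0 \<in> V" using subspace_0[OF subspace_V] .
  have fin: "finite T" using T finite_V by (auto intro: finite_subset[of T "Pow V"])
  have D0: "(\<Sum>U | U \<in> T \<and> perp U 0. card U) = D"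
  proof -
    have "\<beta> x 0 = 0" for x
      using form_scale[of 0 0 x] V0 sym[of x 0] by simp
    then show ?thesis by (simp add: perp_def D_def)
  qed
  have "card T * card V = D + (\<Sum>y\<in>V - {0}. \<Sum>U | U \<in> T \<and> perp U y. card U)"
    using sum_perp_average[of T] T by (simp add: sum.remove[OF finite_V V0] D0)
  moreover have "(\<Sum>y\<in>V - {0}. \<delta>) \<le> (\<Sum>y\<in>V - {0}. \<Sum>U | U \<in> T \<and> perp U y. card U)"
    by (intro sum_mono ge) auto
  ultimately have "D + card (V - {0}) * \<delta> \<le> card T * card V" by simp
  moreover have "card V = card (V - {0}) + 1"
    using card_Suc_Diff1[OF finite_V V0] by simp
  ultimately have main: "D + card (V - {0}) * \<delta> \<le> card T * (card (V - {0}) + 1)" by metis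
  have "2 \<le> card U" if "U \<in> T" for U
  proof -
    have "0 \<in> U" using T that subspace_0 by blast
    moreover have "U \<noteq> {0}" using T that by blast
    ultimately obtain u where "u \<in> U" "u \<noteq> 0" by blast
    then have "card {0, u} \<le> card U"
      using T that finite_V \<open>0 \<in> U\<close> by (intro card_mono) (auto intro: finite_subset)
    then show ?thesis using \<open>u \<noteq> 0\<close> by simp
  qed
  then have "(\<Sum>U\<in>T. 2) \<le> D" unfolding D_def by (rule sum_mono)
  then have D2: "2 * card T \<le> D" by simp
  obtain y where "y \<in> V" "y \<noteq> 0" using V V0 by blast
  then have "\<delta> \<le> (\<Sum>U | U \<in> T \<and> perp U y. card U)" by (rule ge)
  also have "\<dots> \<le> D" unfolding D_def using fin by (intro sum_mono2) auto
  finally have "\<delta> \<le> D" .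
  \<comment> \<open>By \<open>card T \<le> \<delta>\<close>, the terms for nonzero \<open>y\<close>
    already use up \<open>card (V - {0})\<close> copies of \<open>card T\<close> in
    \<open>main\<close>.\<close>
  moreover have "D \<le> card T"
    using main mult_le_mono1[OF le, of "card (V - {0})"]
    by (simp only: distrib_left mult.commute[of _ \<delta>] mult_1_right)
  ultimately show False using D2 \<delta> by simp
qed

end

section \<open>Bounds\<close>

context finite_field_vector_space
begin

lemma dim_zero_subspace [simp]: "dim {0} = 0"
  by (rule dim_unique[of "{}"]) (simp_all only: empty_subsetI span_empty order.refl independent_empty card.empty not_False_eq_True)

text \<open>Every summand in the hyperplane identity is divisible by \<open>q ^ c\<close>.\<close>

lemma card_partition_cong_1:
  assumes V: "subspace V" "finite V" "V \<noteq> {0}" and P: "subspace_partition scale V P"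
    and c: "\<And>U. U \<in> P \<Longrightarrow> c \<le> dim U"
  shows "\<exists>m. card P = 1 + m * q ^ c"
proof -
  obtain \<beta> where "nondegenerate_form scale q V \<beta>"
    using nondegenerate_form_exists[OF V(1,2)] .
  then interpret nondegenerate_form scale q V \<beta> .
  obtain y where y: "y \<in> V" "y \<noteq> 0" using V subspace_0 by blast
  have "q ^ c dvd card U" if "U \<in> P" for U
    using that P c V finite_subset[of U V]
    by (simp add: subspace_partition_def card_subspace le_imp_power_dvd)
  then have "q ^ c dvd (\<Sum>U | U \<in> P \<and> perp U y. card U)"
    by (intro dvd_sum) auto
  then show ?thesis
    using card_partition_eq_sum_perp[OF P y] by (auto simp: dvd_def mult.commute)
qed

end

text \<open>The geometric series with ratio \<open>q ^ t\<close>, stated without subtraction on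
  \<open>nat\<close>.\<close>

lemma power_mult_sum_power:
  fixes q t j :: nat
  shows "(q ^ t) ^ j + (\<Sum>i<j. q ^ (i * t)) = q ^ t * (\<Sum>i<j. q ^ (i * t)) + 1"
proof (induction j)
  case (Suc j)
  have "q ^ (j * t) = (q ^ t) ^ j" by (simp add: mult.commute flip: power_mult)
  with Suc show ?case by (simp add: distrib_left)
qed simp

section \<open>Upper bound when no member has dimension below \<open>t\<close>, lower bound when
  none is above\<close>

context finite_field_vector_space
begin

text \<open>Here \<open>j\<close> stands for \<open>k - 1\<close>. Counting vectors alone gives a
  slightly weaker bound; the congruence modulo \<open>q ^ t\<close> rounds it down to the stated
  value.\<close>

lemma card_partition_le:
  assumes V: "subspace V" "dim V = Suc j * t + r" and r: "r < t"
    and P: "subspace_partition scale V P"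
    and dim: "\<And>U. U \<in> P \<Longrightarrow> t \<le> dim U"
  shows "card P \<le> q ^ (t + r) * (\<Sum>i<j. q ^ (i * t)) + 1"
proof -
  have dim_V: "dim V > 0" using V r by simp
  then have fin: "finite V" using V finite_subspace by blast
  have "V \<noteq> {0}" using dim_V by auto
  then obtain m where m: "card P = 1 + m * q ^ t"
    using card_partition_cong_1[OF V(1) fin _ P dim] by blast
  define Q R S where "Q = int (q ^ t)" and "R = int (q ^ r)" and "S = int (\<Sum>i<j. q ^ (i * t))"
  have RQ: "R < Q" "0 < R" using r q_gt_1 by (simp_all add: R_def Q_def)
  have geo: "Q ^ j + S = Q * S + 1"
    using arg_cong[OF power_mult_sum_power[of q t j], of int]
    by (simp only: Q_def S_def of_nat_1 of_nat_add of_nat_mult of_nat_power)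
  have card_V: "int (card V) = Q * Q ^ j * R"
    by (simp only: card_subspace[OF V(1) fin] V(2) Q_def R_def mult_Suc power_add mult.commute[of j t]
        power_mult of_nat_mult of_nat_power)
  have "q ^ t \<le> card U" if "U \<in> P" for U
  proof -
    have "subspace U" "finite U" using that P fin finite_subset by (auto simp: subspace_partition_def)
    then show ?thesis using that dim q_gt_1 by (simp add: card_subspace)
  qed
  then have "(\<Sum>U\<in>P. q ^ t) \<le> (\<Sum>U\<in>P. card U)" by (rule sum_mono)
  then have "card P * q ^ t + 1 \<le> card V + card P"
    using sum_card_partition[OF V(1) fin P] by simp
  then have "int (card P) * Q + 1 \<le> Q * Q ^ j * R + int (card P)"
    by (simp only: of_nat_add of_nat_mult of_nat_1 card_V Q_def[symmetric] flip: of_nat_le_iff[where 'a = int])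
  moreover have "int (card P) = 1 + int m * Q" by (simp add: m Q_def)
  ultimately have "Q * (1 + int m * Q) \<le> Q * (Q ^ j * R + int m)"
    by (simp add: algebra_simps)
  then have "1 + int m * Q \<le> Q ^ j * R + int m"
    using RQ by (simp add: mult_le_cancel_left)
  also have "Q ^ j = Q * S - S + 1" using geo by simp
  \<comment> \<open>Substituting leaves \<open>m (Q - 1) \<le> R S (Q - 1) + (R - 1)\<close>, and
    the remainder is below \<open>Q - 1\<close> because \<open>r < t\<close>.\<close>
  finally have "int m * (Q - 1) < (R * S + 1) * (Q - 1)"
    using RQ by (simp add: algebra_simps)
  then have "int m \<le> R * S"
    using RQ by (simp add: mult_less_cancel_right)
  then have "m \<le> q ^ r * (\<Sum>i<j. q ^ (i * t))"
    by (simp only: R_def S_def of_nat_mult[symmetric] of_nat_le_iff)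
  then have "m * q ^ t \<le> q ^ r * (\<Sum>i<j. q ^ (i * t)) * q ^ t" by (rule mult_le_mono1)
  then show ?thesis by (simp add: m power_add mult.commute mult.left_commute)
qed

text \<open>\<open>{0}\<close> is excluded because the averaging argument needs every small member
  to contain a nonzero vector.\<close>

lemma card_partition_ge:
  assumes V: "subspace V" "dim V = Suc j * t + r" and r: "0 < r" "r < t"
    and P: "subspace_partition scale V P" "{0} \<notin> P"
    and dim: "\<And>U. U \<in> P \<Longrightarrow> dim U \<le> t"
  shows "q ^ (t + r) * (\<Sum>i<j. q ^ (i * t)) + q ^ ((t + r + 1) div 2) + 1 \<le> card P"
proof (rule ccontr)
  assume less: "\<not> ?thesis"
  have dim_V: "dim V > 0" using V r by simp
  then have fin: "finite V" using V finite_subspace by blast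
  have V0: "V \<noteq> {0}" using dim_V by auto
  have finP: "finite P" using finite_subspace_partition[OF P(1) fin] .
  have sub: "subspace U" "U \<subseteq> V" "finite U" if "U \<in> P" for U
    using that P fin finite_subset by (auto simp: subspace_partition_def)
  obtain \<beta> where "nondegenerate_form scale q V \<beta>"
    using nondegenerate_form_exists[OF V(1) fin] .
  then interpret nondegenerate_form scale q V \<beta> .
  define c where "c = (t + r + 1) div 2"
  define d where "d = c - 1"
  \<comment> \<open>The value of \<open>c\<close> meets two demands: \<open>c \<le> t\<close> makes
    \<open>C\<close> divide \<open>Q\<close>, and \<open>c + d \<le> t + r\<close> gives
    \<open>C * B \<le> Q * R\<close>.\<close>
  have c: "c = Suc d" "c \<le> t" "2 * d + 1 \<le> t + r" using r by (auto simp: c_def d_def)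
  define Q R S B C where "Q = int (q ^ t)" and "R = int (q ^ r)"
    and "S = int (\<Sum>i<j. q ^ (i * t))" and "B = int (q ^ d)" and "C = int (q ^ c)"
  note defs = Q_def R_def S_def B_def C_def
  have Q: "0 < Q" "R > 1" "B > 0" using r q_gt_1 by (simp_all add: defs)
  have CB: "C * B \<le> Q * R"
  proof -
    have "q ^ (c + d) \<le> q ^ (t + r)" using c q_gt_1 by (intro power_increasing) auto
    then show ?thesis by (simp only: defs power_add of_nat_mult[symmetric] of_nat_le_iff)
  qed
  have CQ: "C dvd Q" using c(2) by (simp only: defs of_nat_dvd_iff le_imp_power_dvd)
  have geo: "Q ^ j + S = Q * S + 1"
    using arg_cong[OF power_mult_sum_power[of q t j], of int]
    by (simp only: defs of_nat_1 of_nat_add of_nat_mult of_nat_power)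
  have card_V: "int (card V) = Q * Q ^ j * R"
    by (simp only: card_subspace[OF V(1) fin] V(2) defs mult_Suc power_add mult.commute[of j t]
        power_mult of_nat_mult of_nat_power)
  define \<delta> where "\<delta> = int (card P) - 1 - Q * R * S"
  have \<delta>_less: "\<delta> < C"
  proof -
    have "int (card P) < int (q ^ (t + r) * (\<Sum>i<j. q ^ (i * t)) + q ^ c + 1)"
      using less by (simp only: c_def not_le of_nat_less_iff)
    then have "int (card P) < Q * R * S + C + 1"
      by (simp only: power_add of_nat_add of_nat_mult of_nat_1 defs)
    then show ?thesis by (simp add: \<delta>_def)
  qed
  define T where "T = {U \<in> P. dim U < c}"
  have T: "finite T" "T \<subseteq> P" using finP by (auto simp: T_def)
  have card_le: "card U \<le> q ^ t" if "U \<in> P" for U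
    using that sub dim q_gt_1 by (simp add: card_subspace)
  have card_T: "card U \<le> q ^ d" if "U \<in> T" for U
    using that sub q_gt_1 c(1) by (auto simp: card_subspace T_def)
  \<comment> \<open>Vectors are counted with at most \<open>q ^ t\<close> for each member outside
    \<open>T\<close> and \<open>q ^ d\<close> for each inside; the geometric series then eliminates
    \<open>Q ^ j\<close> and \<open>S\<close>.\<close>
  have main: "Q * R + \<delta> + int (card T) * (Q - B) \<le> Q + \<delta> * Q"
  proof -
    have "(\<Sum>U\<in>P. card U) = (\<Sum>U\<in>P - T. card U) + (\<Sum>U\<in>T. card U)"
      by (rule sum.subset_diff[OF T(2) finP])
    also have "\<dots> \<le> (\<Sum>U\<in>P - T. q ^ t) + (\<Sum>U\<in>T. q ^ d)"
      using card_le card_T by (intro add_mono sum_mono) auto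
    finally have "card V + card P \<le> card (P - T) * q ^ t + card T * q ^ d + 1"
      using sum_card_partition[OF V(1) fin P(1)] by simp
    then have "int (card V) + int (card P) \<le> int (card (P - T)) * Q + int (card T) * B + 1"
      by (simp only: of_nat_add of_nat_mult of_nat_1 Q_def[symmetric] B_def[symmetric] flip: of_nat_le_iff[where 'a = int])
    moreover have "int (card (P - T)) = int (card P) - int (card T)"
      using T finP by (simp add: card_Diff_subset card_mono of_nat_diff)
    moreover have "int (card P) = 1 + Q * R * S + \<delta>" by (simp add: \<delta>_def)
    moreover have "Q ^ j = Q * S - S + 1" using geo by simp
    ultimately show ?thesis unfolding card_V by (simp add: algebra_simps)
  qed
  \<comment> \<open>Discarding the contribution of \<open>T\<close> from \<open>main\<close> leaves
    \<open>Q * (R - 1) \<le> \<delta> * (Q - 1)\<close>, and \<open>R > 1\<close> as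
    \<open>r > 0\<close>.\<close>
  have \<delta>_pos: "\<delta> > 0"
  proof -
    have "q ^ d \<le> q ^ t" using c q_gt_1 by (intro power_increasing) auto
    then have "B \<le> Q" by (simp only: defs of_nat_le_iff)
    then have "0 \<le> int (card T) * (Q - B)" by simp
    then have "Q * (R - 1) \<le> \<delta> * (Q - 1)" using main by (simp add: algebra_simps)
    moreover have "0 < Q * (R - 1)" using Q by simp
    ultimately have "0 < \<delta> * (Q - 1)" by linarith
    then show ?thesis using Q by (simp add: zero_less_mult_iff)
  qed
  have "card T > nat \<delta>"
  proof (rule card_gt_of_sum_perp_ge)
    fix y assume y: "y \<in> V" "y \<noteq> 0"
    define f where "f = (\<Sum>U | U \<in> T \<and> perp U y. card U)"
    define g where "g = (\<Sum>U | U \<in> P - T \<and> perp U y. card U)"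
    have "{U. U \<in> P \<and> perp U y} = {U. U \<in> T \<and> perp U y} \<union> {U. U \<in> P - T \<and> perp U y}"
      using T by auto
    moreover have "(\<Sum>U\<in>{U. U \<in> T \<and> perp U y} \<union> {U. U \<in> P - T \<and> perp U y}. card U) = f + g"
      unfolding f_def g_def using T finP by (intro sum.union_disjoint) auto
    ultimately have fg: "card P = 1 + (f + g)"
      using card_partition_eq_sum_perp[OF P(1) y] by simp
    have "q ^ c dvd card U" if "U \<in> P - T" for U
      using that sub by (auto simp: T_def card_subspace not_less le_imp_power_dvd)
    then have "q ^ c dvd g" unfolding g_def by (intro dvd_sum) auto
    then have "C dvd int g" by (simp only: C_def of_nat_dvd_iff)
    then have dvd: "C dvd Q * R * S - int g" using CQ by (intro dvd_diff) auto
    have eq: "\<delta> - int f = - (Q * R * S - int g)" using fg by (simp add: \<delta>_def)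
    \<comment> \<open>\<open>\<delta> - int f\<close> is a multiple of \<open>C\<close>, because
      \<open>C\<close> divides \<open>Q\<close> and the sizes of all members outside
      \<open>T\<close>; a positive multiple would be at least \<open>C\<close>, which exceeds
      \<open>\<delta>\<close>.\<close>
    have "\<delta> \<le> int f"
    proof (rule ccontr)
      assume "\<not> \<delta> \<le> int f"
      moreover have "C dvd \<delta> - int f" unfolding eq using dvd by (simp only: dvd_minus_iff)
      ultimately have "C \<le> \<delta> - int f" by (intro zdvd_imp_le) auto
      then show False using \<delta>_less by simp
    qed
    then show "nat \<delta> \<le> (\<Sum>U | U \<in> T \<and> perp U y. card U)" by (simp only: f_def[symmetric] nat_le_iff)
  qed (use T P sub V0 \<delta>_pos in auto)
  then have T_gt: "\<delta> + 1 \<le> int (card T)" using \<delta>_pos by linarith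
  have "q ^ d \<le> q ^ t" using c q_gt_1 by (intro power_increasing) auto
  then have "0 \<le> Q - B" by (simp only: defs of_nat_le_iff diff_ge_0_iff_ge)
  with T_gt have "(\<delta> + 1) * (Q - B) \<le> int (card T) * (Q - B)" by (rule mult_right_mono)
  \<comment> \<open>The many small members turn the vector count into
    \<open>Q * R + \<delta> \<le> C * B\<close>, against \<open>C * B \<le> Q * R\<close>.\<close>
  with main have "Q * R + \<delta> \<le> (\<delta> + 1) * B" by (simp add: algebra_simps)
  also have "\<dots> \<le> C * B" using \<delta>_less Q by (intro mult_right_mono) auto
  finally show False using CB \<delta>_pos by simp
qed

end

section \<open>Constructions\<close>

text \<open>Over the base field, the field with \<open>q ^ m\<close> elements becomes a subspace of
  the closure and can be matched linearly with subspaces of \<open>V\<close>.\<close>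

interpretation alg_closure: vector_space "\<lambda>(c :: 'a::{field,finite}) x. to_ac c * x"
  by unfold_locales (simp_all add: algebra_simps)

context finite_field_vector_space
begin

lemma complement_exists:
  assumes V: "subspace V" "dim V = m + t" "0 < m + t"
  obtains W T where "subspace W" "subspace T" "dim W = m" "dim T = t"
    "V = {w + x | w x. w \<in> W \<and> x \<in> T}" "W \<inter> T = {0}"
proof -
  have fin: "finite V" using V finite_subspace by simp
  obtain B where B: "B \<subseteq> V" "independent B" "V \<subseteq> span B" "card B = dim V"
    by (rule basis_exists)
  have finB: "finite B" using B fin finite_subset by blast
  obtain C where C: "C \<subseteq> B" "card C = m"
    using obtain_subset_with_card_n[of m B] B(4) V(2) by (metis le_add1)
  define W T where "W = span C" and "T = span (B - C)"
  have ind: "independent C" "independent (B - C)"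
    using B C independent_mono by blast+
  have cardBC: "card (B - C) = t"
    using B V C finB by (simp add: card_Diff_subset finite_subset)
  have sub: "subspace W" "subspace T" by (simp_all add: W_def T_def)
  have dims: "dim W = m" "dim T = t"
    using ind C cardBC by (simp_all add: W_def T_def dim_eq_card_independent)
  have "V = span (C \<union> (B - C))"
    using B C V span_subspace[of B V] by (simp add: Un_absorb1)
  also have "\<dots> = {w + x | w x. w \<in> W \<and> x \<in> T}"
    unfolding span_Un W_def T_def by blast
  finally have sum: "V = {w + x | w x. w \<in> W \<and> x \<in> T}" .
  have "W \<subseteq> V" "T \<subseteq> V"
    using B(1) C(1) V(1) unfolding W_def T_def by (intro span_minimal; blast)+
  then have finWT: "finite W" "finite T" using fin finite_subset by blast+
  \<comment> \<open>The sum map is onto \<open>V\<close> and both sides have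
    \<open>q ^ (m + t)\<close> elements, so it is injective; the trivial intersection
    follows.\<close>
  have "inj_on (\<lambda>(w, x). w + x) (W \<times> T)"
  proof (rule eq_card_imp_inj_on)
    have "(\<lambda>(w, x). w + x) ` (W \<times> T) = V" by (auto simp: sum)
    then show "card ((\<lambda>(w, x). w + x) ` (W \<times> T)) = card (W \<times> T)"
      using sub finWT dims V fin by (simp add: card_cartesian_product card_subspace power_add)
  qed (use finWT in simp)
  then have "x = 0" if "x \<in> W \<inter> T" for x
    using that sub subspace_0 inj_onD[of "\<lambda>(w, x). w + x" "W \<times> T" "(x, 0)" "(0, x)"] by auto
  then have "W \<inter> T = {0}" using sub subspace_0 by auto
  then show ?thesis using that sub dims sum by blast
qed

lemma dim_eqI_card:
  assumes "subspace U" "finite U" "card U = q ^ m"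
  shows "dim U = m"
  using card_subspace[OF assms(1,2)] assms(3) q_gt_1 power_inject_exp by metis

lemma linear_isomorphism_exists:
  assumes "vector_space s2" "subspace S" "module.subspace s2 T" "dim S = vector_space.dim s2 T"
    and "finite S" "finite T"
  obtains f where "Vector_Spaces.linear scale s2 f" "f ` S = T" "inj_on f S"
proof -
  interpret v2: vector_space s2 by fact
  interpret vector_space_pair scale s2 ..
  obtain B where B: "B \<subseteq> S" "independent B" "S \<subseteq> span B" "card B = dim S"
    by (rule basis_exists)
  obtain C where C: "C \<subseteq> T" "v2.independent C" "T \<subseteq> v2.span C" "card C = v2.dim T"
    by (rule v2.basis_exists)
  have "finite B" "finite C" using B C assms finite_subset by blast+
  then show ?thesis
    using finite_basis_to_basis_subspace_isomorphism[OF assms(2,3,4) _ B _ C] that by blast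
qed

lemma subspace_exists_of_dim:
  assumes "subspace U" "t \<le> dim U"
  obtains T where "subspace T" "T \<subseteq> U" "dim T = t"
proof -
  obtain B where B: "B \<subseteq> U" "independent B" "U \<subseteq> span B" "card B = dim U"
    by (rule basis_exists)
  obtain C where C: "C \<subseteq> B" "card C = t"
    using obtain_subset_with_card_n[of t B] B(4) assms(2) by metis
  have "independent C" using B C independent_mono by blast
  with B C assms that[of "span C"] show ?thesis
    by (simp add: dim_eq_card_independent span_minimal)
qed

end

lemma subspace_subfield_of_degree:
  "alg_closure.subspace (subfield_of_degree m)"
  by (auto simp: alg_closure.subspace_def zero_in_subfield_of_degree subfield_of_degree_add
      intro!: subfield_of_degree_mult to_ac_in_subfield_of_degree)

section \<open>Partitions into one large subspace and many of dimension \<open>t\<close>\<close>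

context finite_field_vector_space
begin

text \<open>With \<open>V = W \<oplus> T\<close>, \<open>W\<close> identified by \<open>\<theta>\<close> with the field \<open>L\<close> of \<open>q^m\<close> elements and \<open>T\<close> embedded
  into it by \<open>\<psi>\<close>, the vectors \<open>w + x\<close> outside \<open>W\<close> are classified by the slope \<open>\<theta> w / \<psi> x\<close>.\<close>

lemma partition_with_large_subspace_exists:
  assumes V: "subspace V" "dim V = m + t" and t: "0 < t" "t \<le> m"
  obtains W P where "subspace W" "dim W = m" "W \<notin> P" "card P = q ^ m"
    "\<And>U. U \<in> P \<Longrightarrow> dim U = t" "subspace_partition scale V (insert W P)"
proof -
  have fin: "finite V" using V t finite_subspace by simp
  have "0 < m + t" using t by simp
  then obtain W T where sub: "subspace W" "subspace T" and dims: "dim W = m" "dim T = t"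
    and sum: "V = {w + x | w x. w \<in> W \<and> x \<in> T}" and int: "W \<inter> T = {0}"
    by (rule complement_exists[OF V])
  have finWT: "finite W" "finite T" using sub dims t finite_subspace by auto
  define L :: "'a alg_closure set" where "L = subfield_of_degree m"
  have card_L: "card L = q ^ m"
    using t card_subfield_of_degree[of m, where 'a = 'a] by (simp add: L_def card_field)
  then have finL: "finite L" using q_gt_1 by (intro card_ge_0_finite) simp
  have sub_L: "alg_closure.subspace L" by (simp add: L_def subspace_subfield_of_degree)
  interpret L: finite_field_vector_space "\<lambda>(c :: 'a) x. to_ac c * x" q
    by unfold_locales (rule card_field)
  have dim_L: "alg_closure.dim L = m"
    using L.dim_eqI_card[OF sub_L finL card_L] .
  \<comment> \<open>\<open>t \<le> m\<close> makes room in the field for the copy \<open>M\<close>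
    of \<open>T\<close>.\<close>
  obtain M where M: "alg_closure.subspace M" "M \<subseteq> L" "alg_closure.dim M = t"
    using L.subspace_exists_of_dim[OF sub_L, of t] dim_L t by auto
  have finM: "finite M" using M finL finite_subset by blast
  obtain \<theta> where \<theta>: "Vector_Spaces.linear scale (\<lambda>c x. to_ac c * x) \<theta>" "\<theta> ` W = L" "inj_on \<theta> W"
    using linear_isomorphism_exists[OF alg_closure.vector_space_axioms sub(1) sub_L] dims dim_L finWT finL by metis
  obtain \<psi> where \<psi>: "Vector_Spaces.linear scale (\<lambda>c x. to_ac c * x) \<psi>" "\<psi> ` T = M" "inj_on \<psi> T"
    using linear_isomorphism_exists[OF alg_closure.vector_space_axioms sub(2) M(1)] dims M(3) finWT finM by metis
  interpret \<theta>: Vector_Spaces.linear scale "\<lambda>c x. to_ac c * x" \<theta> by (fact \<theta>(1))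
  interpret \<psi>: Vector_Spaces.linear scale "\<lambda>c x. to_ac c * x" \<psi> by (fact \<psi>(1))
  have \<theta>0: "w = 0" if "w \<in> W" "\<theta> w = 0" for w
    using inj_onD[OF \<theta>(3), of w 0] that sub subspace_0 \<theta>.zero by simp
  have \<psi>0: "x = 0" if "x \<in> T" "\<psi> x = 0" for x
    using inj_onD[OF \<psi>(3), of x 0] that sub subspace_0 \<psi>.zero by simp
  have unique: "w = w' \<and> x = x'" if "w \<in> W" "w' \<in> W" "x \<in> T" "x' \<in> T" "w + x = w' + x'" for w w' x x'
  proof -
    have "w - w' = x' - x" using that(5) by (simp add: algebra_simps)
    moreover have "w - w' \<in> W" "x' - x \<in> T" using that sub subspace_diff by auto
    ultimately have "x' - x \<in> W \<inter> T" by simp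
    then have "x' - x = 0" using int by simp
    with \<open>w - w' = x' - x\<close> show ?thesis by simp
  qed
  \<comment> \<open>The vectors of slope \<open>a\<close>, written without division so that 0
    belongs to each class.\<close>
  define U where "U a = {w + x | w x. w \<in> W \<and> x \<in> T \<and> \<theta> w = a * \<psi> x}" for a
  have U_iff: "w + x \<in> U a \<longleftrightarrow> \<theta> w = a * \<psi> x" if "w \<in> W" "x \<in> T" for w x a
    unfolding U_def using that unique by blast
  have U_sub: "subspace (U a)" for a
  proof (rule subspaceI)
    show "0 \<in> U a"
      using U_iff[of 0 0 a] sub subspace_0 \<theta>.zero \<psi>.zero by simp
  next
    fix u v assume "u \<in> U a" "v \<in> U a"
    then obtain w x w' x' where *: "u = w + x" "w \<in> W" "x \<in> T" "\<theta> w = a * \<psi> x"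
      "v = w' + x'" "w' \<in> W" "x' \<in> T" "\<theta> w' = a * \<psi> x'"
      unfolding U_def by blast
    have "(w + w') + (x + x') \<in> U a"
      using * sub by (subst U_iff) (auto simp: subspace_add \<theta>.add \<psi>.add distrib_left)
    then show "u + v \<in> U a" by (simp add: * ac_simps)
  next
    fix c u assume "u \<in> U a"
    then obtain w x where *: "u = w + x" "w \<in> W" "x \<in> T" "\<theta> w = a * \<psi> x"
      unfolding U_def by blast
    have "c *s w + c *s x \<in> U a"
      using * sub by (subst U_iff) (auto simp: subspace_scale \<theta>.scale \<psi>.scale)
    then show "c *s u \<in> U a" by (simp add: * scale_right_distrib)
  qed
  have U_V: "U a \<subseteq> V" for a unfolding U_def sum by blast
  have lift: "\<exists>w\<in>W. \<theta> w = a * \<psi> x" if "a \<in> L" "x \<in> T" for a x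
  proof -
    have "a * \<psi> x \<in> L"
      using that \<psi>(2) M(2) by (auto simp: L_def intro!: subfield_of_degree_mult)
    then show ?thesis using \<theta>(2) by force
  qed
  have dim_U: "dim (U a) = t" if a: "a \<in> L" for a
  proof (rule dim_eqI_card[OF U_sub])
    show "finite (U a)" using U_V fin finite_subset by blast
    \<comment> \<open>\<open>U a\<close> is the graph of \<open>h\<close> over \<open>T\<close>, so
      it has as many vectors as \<open>T\<close>.\<close>
    define h where "h x = (SOME w. w \<in> W \<and> \<theta> w = a * \<psi> x)" for x
    have h: "h x \<in> W" "\<theta> (h x) = a * \<psi> x" if "x \<in> T" for x
      using someI_ex[of "\<lambda>w. w \<in> W \<and> \<theta> w = a * \<psi> x"] lift[OF a that] unfolding h_def by blast+
    have "bij_betw (\<lambda>x. h x + x) T (U a)"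
      unfolding bij_betw_def
    proof
      show "inj_on (\<lambda>x. h x + x) T" using h unique by (meson inj_onI)
      show "(\<lambda>x. h x + x) ` T = U a"
      proof (intro equalityI subsetI)
        fix v assume "v \<in> U a"
        then obtain w x where *: "v = w + x" "w \<in> W" "x \<in> T" "\<theta> w = a * \<psi> x"
          unfolding U_def by blast
        then have "w = h x" using h inj_onD[OF \<theta>(3), of w "h x"] by simp
        then show "v \<in> (\<lambda>x. h x + x) ` T" using * by blast
      qed (auto simp: U_iff h)
    qed
    then show "card (U a) = q ^ t"
      using bij_betw_same_card card_subspace[OF sub(2) finWT(2)] dims by metis
  qed
  have separate: "a = b" if "v \<in> U a" "v \<in> U b" "v \<noteq> 0" for a b v
  proof -
    obtain w x where *: "v = w + x" "w \<in> W" "x \<in> T" "\<theta> w = a * \<psi> x"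
      using \<open>v \<in> U a\<close> unfolding U_def by blast
    then have "\<theta> w = b * \<psi> x" using \<open>v \<in> U b\<close> U_iff by simp
    moreover have "\<psi> x \<noteq> 0"
      using * \<theta>0 \<psi>0 \<open>v \<noteq> 0\<close> by force
    ultimately show ?thesis using *(4) by simp
  qed
  have U_W: "v = 0" if "v \<in> U a" "v \<in> W" for a v
  proof -
    have "v + 0 \<in> U a" using that by simp
    then have "\<theta> v = a * \<psi> 0" using U_iff[of v 0] that sub subspace_0 by blast
    then show ?thesis using \<theta>0 that by (simp add: \<psi>.zero)
  qed
  have nonzero: "\<exists>v\<in>U a. v \<noteq> 0" if "a \<in> L" for a
  proof (rule ccontr)
    assume "\<not> ?thesis"
    then have "U a = {0}" using subspace_0[OF U_sub] by blast
    then show False using dim_U[OF that] t by simp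
  qed
  define P where "P = U ` L"
  have "W \<notin> P" using nonzero U_W by (auto simp: P_def)
  moreover have "card P = q ^ m"
  proof -
    have "inj_on U L" using nonzero separate by (metis inj_onI)
    then show ?thesis by (simp add: P_def card_image card_L)
  qed
  moreover have "dim Z = t" if "Z \<in> P" for Z using that dim_U by (auto simp: P_def)
  moreover have "subspace_partition scale V (insert W P)"
    unfolding subspace_partition_iff[OF V(1)]
  proof (intro conjI ballI)
    fix Z assume "Z \<in> insert W P"
    moreover have "W \<subseteq> V"
    proof
      fix w assume "w \<in> W"
      moreover have "w = w + 0" "0 \<in> T" using sub subspace_0 by auto
      ultimately show "w \<in> V" unfolding sum by blast
    qed
    ultimately show "subspace Z" "Z \<subseteq> V" using sub U_sub U_V by (auto simp: P_def)
  next
    fix v assume v: "v \<in> V - {0}"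
    then obtain w x where *: "v = w + x" "w \<in> W" "x \<in> T" unfolding sum by blast
    have "\<exists>Z. Z \<in> insert W P \<and> v \<in> Z"
    proof (cases "x = 0")
      case False
      then have "\<psi> x \<noteq> 0" using * \<psi>0 by blast
      \<comment> \<open>A vector outside \<open>W\<close> lies in the class of its slope, and the
        slope is in \<open>L\<close> because a field is closed under division.\<close>
      then have "v \<in> U (\<theta> w / \<psi> x)" using * U_iff by simp
      moreover have "\<theta> w / \<psi> x \<in> L"
        unfolding L_def using * \<theta>(2) \<psi>(2) M(2) by (intro subfield_of_degree_divide) (auto simp: L_def)
      ultimately show ?thesis by (auto simp: P_def)
    qed (use * in auto)
    moreover have "Z = Z'" if "Z \<in> insert W P" "Z' \<in> insert W P" "v \<in> Z" "v \<in> Z'" for Z Z'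
      using that v separate U_W by (auto simp: P_def)
    ultimately show "\<exists>!Z. Z \<in> insert W P \<and> v \<in> Z" by blast
  qed
  ultimately show ?thesis using that sub(1) dims(1) by blast
qed

text \<open>\<open>W\<close> is replaced by a partition of itself; \<open>W \<notin> P\<close>
  ensures that no nonzero vector of \<open>W\<close> is covered by \<open>P\<close> as well.\<close>

lemma subspace_partition_refine:
  assumes V: "subspace V" and W: "subspace W"
    and P: "subspace_partition scale V (insert W P)" "W \<notin> P"
    and Q: "subspace_partition scale W Q"
  shows "subspace_partition scale V (P \<union> Q)"
  unfolding subspace_partition_iff[OF V]
proof (intro conjI ballI)
  note P' = P(1)[unfolded subspace_partition_iff[OF V]]
  note Q' = Q[unfolded subspace_partition_iff[OF W]]
  have "W \<subseteq> V" using P' by simp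
  then show "subspace U" "U \<subseteq> V" if "U \<in> P \<union> Q" for U
    using that P' Q' order.trans[of U W V] by (auto simp del: Diff_iff)
  fix v assume v: "v \<in> V - {0}"
  then have ex: "\<exists>!U. U \<in> insert W P \<and> v \<in> U" using P' by blast
  show "\<exists>!U. U \<in> P \<union> Q \<and> v \<in> U"
  proof (cases "v \<in> W")
    case True
    then have "\<And>U. U \<in> P \<Longrightarrow> v \<notin> U" using ex P(2) by blast
    moreover have "\<exists>!U. U \<in> Q \<and> v \<in> U" using Q' True v by blast
    ultimately show ?thesis by blast
  next
    case False
    then have "\<And>U. U \<in> Q \<Longrightarrow> v \<notin> U" using Q' by blast
    with ex False show ?thesis by blast
  qed
qed

text \<open>A member other than \<open>W\<close> shares only the zero vector with it. Hence the
  pieces of \<open>W\<close> are new members, and sizes add up in a refinement.\<close>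

lemma subspace_partition_member_not_subset:
  assumes V: "subspace V" and W: "W \<subseteq> V"
    and P: "subspace_partition scale V (insert W P)" "W \<notin> P"
    and U: "U \<in> P" "0 < dim U"
  shows "\<not> U \<subseteq> W"
proof
  assume sub: "U \<subseteq> W"
  have "subspace U" using P U by (auto simp: subspace_partition_def)
  moreover have "U \<noteq> {0}" using U by auto
  ultimately obtain u where "u \<in> U" "u \<noteq> 0" using subspace_0 by blast
  then have "\<exists>!Z. Z \<in> insert W P \<and> u \<in> Z"
    using P(1)[unfolded subspace_partition_iff[OF V]] sub W by blast
  moreover have "u \<in> W" using \<open>u \<in> U\<close> sub by blast
  ultimately have "U = W" using \<open>u \<in> U\<close> U(1) by blast
  then show False using U(1) P(2) by simp
qed

text \<open>Reducing the large part from dimension \<open>s + (i + 1) * t\<close> to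
  \<open>s + i * t\<close> creates \<open>q ^ (s + i * t)\<close> members, whence the geometric sum.
  The bound \<open>t \<le> s\<close> keeps the large part of dimension at least
  \<open>t\<close>.\<close>

lemma iterated_partition_exists:
  assumes "subspace V" "dim V = j * t + s" and t: "0 < t" "t \<le> s"
  obtains W P where "subspace W" "dim W = s" "W \<subseteq> V" "W \<notin> P"
    "card P = q ^ s * (\<Sum>i<j. q ^ (i * t))"
    "\<And>U. U \<in> P \<Longrightarrow> dim U = t" "subspace_partition scale V (insert W P)"
  using assms
proof (induction j arbitrary: V thesis)
  case 0
  have "subspace_partition scale V {V}"
    using 0 by (auto simp: subspace_partition_iff)
  with 0 show ?case by (intro "0.prems"(1)[of V "{}"]) auto
next
  case (Suc j)
  have V: "subspace V" "dim V = (j * t + s) + t" using Suc.prems by auto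
  obtain W' P' where W': "subspace W'" "dim W' = j * t + s" "W' \<notin> P'" "card P' = q ^ (j * t + s)"
    "\<And>U. U \<in> P' \<Longrightarrow> dim U = t" "subspace_partition scale V (insert W' P')"
    using partition_with_large_subspace_exists[OF V] t by (metis trans_le_add2)
  obtain W P where W: "subspace W" "dim W = s" "W \<subseteq> W'" "W \<notin> P"
    "card P = q ^ s * (\<Sum>i<j. q ^ (i * t))"
    "\<And>U. U \<in> P \<Longrightarrow> dim U = t" "subspace_partition scale W' (insert W P)"
    using Suc.IH[OF _ W'(1,2) t] by blast
  have fin: "finite V" using V t finite_subspace by simp
  have sub: "W' \<subseteq> V" using W'(6) by (auto simp: subspace_partition_def)
  have part: "subspace_partition scale V (P' \<union> insert W P)"
    using subspace_partition_refine[OF V(1) W'(1,6,3) W(7)] .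
  have finP: "finite (P' \<union> insert W P)" using finite_subspace_partition[OF part fin] .
  have "\<not> U \<subseteq> W'" if "U \<in> P'" for U
    using subspace_partition_member_not_subset[OF V(1) sub W'(6,3) that] W'(5)[OF that] t by simp
  moreover have "U \<subseteq> W'" if "U \<in> insert W P" for U
    using W(7) that by (auto simp: subspace_partition_def)
  ultimately have disj: "P' \<inter> insert W P = {}" by blast
  show ?case
  proof (rule Suc.prems(1)[of W "P \<union> P'"])
    show "W \<subseteq> V" using W sub by blast
    show "W \<notin> P \<union> P'" using W disj by blast
    show "card (P \<union> P') = q ^ s * (\<Sum>i<Suc j. q ^ (i * t))"
      using disj finP W W' by (subst card_Un_disjoint) (auto simp: power_add algebra_simps)
    show "dim U = t" if "U \<in> P \<union> P'" for U using that W W' by blast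
    show "subspace_partition scale V (insert W (P \<union> P'))"
      using part by (simp add: Un_commute)
  qed (use W in auto)
qed

text \<open>The remaining subspace of dimension \<open>t + r\<close> is kept whole as the one extra
  member.\<close>

lemma maximal_partition_exists:
  assumes V: "subspace V" "dim V = Suc j * t + r" and t: "0 < t" "0 < j"
  obtains P where "subspace_partition scale V P" "\<exists>U\<in>P. dim U = t" "\<forall>U\<in>P. t \<le> dim U"
    "card P = q ^ (t + r) * (\<Sum>i<j. q ^ (i * t)) + 1"
proof -
  have fin: "finite V" using V t finite_subspace by simp
  obtain W P where W: "subspace W" "dim W = t + r" "W \<subseteq> V" "W \<notin> P"
    "card P = q ^ (t + r) * (\<Sum>i<j. q ^ (i * t))"
    "\<And>U. U \<in> P \<Longrightarrow> dim U = t" and part: "subspace_partition scale V (insert W P)"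
    by (rule iterated_partition_exists[OF V(1), of j t "t + r"]) (use V(2) t in auto)
  have "finite (insert W P)" using finite_subspace_partition[OF part fin] .
  \<comment> \<open>\<open>j > 0\<close> makes \<open>P\<close> nonempty, which supplies a member of
    dimension exactly \<open>t\<close>; \<open>W\<close> itself has dimension
    \<open>t + r\<close>.\<close>
  moreover have "0 < (\<Sum>i<j. q ^ (i * t))"
    using t q_gt_1 by (intro sum_pos) auto
  then have "card P > 0" using W(5) q_gt_1 by simp
  then obtain U where "U \<in> P" by (metis card_gt_0_iff ex_in_conv)
  ultimately show ?thesis
    using W by (intro that[OF part]) (auto intro!: bexI[of _ U])
qed

text \<open>The remaining subspace of dimension \<open>t + r\<close> is too large and is split once
  more, as evenly as possible: one part of dimension \<open>c = \<lceil>(t + r) / 2\<rceil>\<close>,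
  at most \<open>t\<close> since \<open>r < t\<close>, and \<open>q ^ c\<close> parts of dimension
  \<open>t + r - c\<close>.\<close>

lemma minimal_partition_exists:
  assumes V: "subspace V" "dim V = Suc j * t + r" and t: "0 < r" "r < t" "0 < j"
  obtains P where "subspace_partition scale V P" "\<exists>U\<in>P. dim U = t" "\<forall>U\<in>P. dim U \<le> t"
    "card P = q ^ (t + r) * (\<Sum>i<j. q ^ (i * t)) + q ^ ((t + r + 1) div 2) + 1"
proof -
  have fin: "finite V" using V t finite_subspace by simp
  obtain W P where W: "subspace W" "dim W = t + r" "W \<subseteq> V" "W \<notin> P"
    "card P = q ^ (t + r) * (\<Sum>i<j. q ^ (i * t))"
    "\<And>U. U \<in> P \<Longrightarrow> dim U = t" and part: "subspace_partition scale V (insert W P)"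
    by (rule iterated_partition_exists[OF V(1), of j t "t + r"]) (use V(2) t in auto)
  define c where "c = (t + r + 1) div 2"
  have c: "dim W = c + (t + r - c)" "0 < t + r - c" "t + r - c \<le> c" "c \<le> t"
    using t W by (auto simp: c_def)
  obtain W' P' where W': "dim W' = c" "W' \<notin> P'" "card P' = q ^ c"
    "\<And>U. U \<in> P' \<Longrightarrow> dim U = t + r - c" and part': "subspace_partition scale W (insert W' P')"
    using partition_with_large_subspace_exists[OF W(1) c(1-3)] by metis
  have part_V: "subspace_partition scale V (P \<union> insert W' P')"
    using subspace_partition_refine[OF V(1) W(1) part W(4) part'] .
  have finP: "finite (P \<union> insert W' P')" using finite_subspace_partition[OF part_V fin] .
  have "\<not> U \<subseteq> W" if "U \<in> P" for U
    using subspace_partition_member_not_subset[OF V(1) W(3) part W(4) that] W(6)[OF that] t by simp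
  moreover have "U \<subseteq> W" if "U \<in> insert W' P'" for U
    using part' that by (auto simp: subspace_partition_def)
  ultimately have disj: "P \<inter> insert W' P' = {}" by blast
  have "0 < (\<Sum>i<j. q ^ (i * t))"
    using t q_gt_1 by (intro sum_pos) auto
  then have "card P > 0" using W(5) q_gt_1 by simp
  then obtain U where U: "U \<in> P" by (metis card_gt_0_iff ex_in_conv)
  show ?thesis
  proof (rule that[OF part_V])
    show "\<exists>U\<in>P \<union> insert W' P'. dim U = t" using U W by blast
    show "\<forall>U\<in>P \<union> insert W' P'. dim U \<le> t" using W W' c t by auto
    have "card (P \<union> insert W' P') = card P + card (insert W' P')"
      using disj finP by (intro card_Un_disjoint) auto
    then show "card (P \<union> insert W' P') = q ^ (t + r) * (\<Sum>i<j. q ^ (i * t)) + q ^ ((t + r + 1) div 2) + 1"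
      using finP W W' by (simp add: c_def)
  qed
qed

end

section \<open>The bounds and the constructions combined into the two extremal values\<close>

theorem theorem1:
  fixes scale :: "'a::{field,finite} \<Rightarrow> 'b::ab_group_add \<Rightarrow> 'b"
    and V :: "'b set" and q n k t r :: nat
  assumes "vector_space scale"
    and "CARD('a) = q"
    and "module.subspace scale V"
    and "vector_space.dim scale V = n"
    and "r < t" and "k \<ge> 2" and "n = k * t + r"
  shows "rho_max scale V t = q ^ (t + r) * (\<Sum>i=0..k-2. q ^ (i * t)) + 1 \<and>
    (1 \<le> r \<longrightarrow> sigma_min scale V t =
       q ^ (t + r) * (\<Sum>i=0..k-2. q ^ (i * t)) + q ^ nat \<lceil>real (t + r) / 2\<rceil> + 1)"
proof -
  interpret vector_space scale by fact
  interpret finite_field_vector_space scale q by unfold_locales fact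
  obtain j where j: "k = Suc j" "0 < j" using \<open>k \<ge> 2\<close> by (cases k) auto
  have V: "subspace V" "dim V = Suc j * t + r" and t: "0 < t"
    using assms j by simp_all
  have fin: "finite V" using V t finite_subspace by simp
  have sum_eq: "(\<Sum>i=0..k-2. q ^ (i * t)) = (\<Sum>i<j. q ^ (i * t))"
    using j by (intro sum.cong) auto
  \<comment> \<open>\<open>Max\<close> and \<open>Min\<close> are characterised only on finite sets;
    a partition is a set of subsets of the finite \<open>V\<close>.\<close>
  have finite_cards: "finite {card P | P. subspace_partition scale V P \<and> R P}" for R
  proof (rule finite_subset)
    show "{card P | P. subspace_partition scale V P \<and> R P} \<subseteq> card ` Pow (Pow V)"
      by (auto simp: subspace_partition_def)
  qed (use fin in simp)
  have "rho_max scale V t = q ^ (t + r) * (\<Sum>i<j. q ^ (i * t)) + 1"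
    unfolding rho_max_def
  proof (rule Max_eqI[OF finite_cards])
    show "q ^ (t + r) * (\<Sum>i<j. q ^ (i * t)) + 1 \<in> {card P | P. subspace_partition scale V P \<and>
        (\<exists>U\<in>P. dim U = t) \<and> (\<forall>U\<in>P. t \<le> dim U)}"
      using maximal_partition_exists[OF V t j(2)] by (smt (verit) mem_Collect_eq)
  qed (use card_partition_le[OF V \<open>r < t\<close>] in auto)
  moreover have "sigma_min scale V t =
      q ^ (t + r) * (\<Sum>i<j. q ^ (i * t)) + q ^ ((t + r + 1) div 2) + 1" if r: "1 \<le> r"
    unfolding sigma_min_def
  proof (rule Min_eqI[OF finite_cards])
    fix y assume "y \<in> {card P | P. subspace_partition scale V P \<and>
        (\<exists>U\<in>P. dim U = t) \<and> (\<forall>U\<in>P. dim U \<le> t)}"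
    then obtain P where P: "y = card P" "subspace_partition scale V P" "\<forall>U\<in>P. dim U \<le> t"
      by blast
    \<comment> \<open>The definition admits the zero subspace as a member; removing it preserves the
      partition and does not raise the size.\<close>
    have "subspace_partition scale V (P - {{0}})"
      using P(2) unfolding subspace_partition_iff[OF V(1)] by (metis Diff_iff singletonD)
    then have "q ^ (t + r) * (\<Sum>i<j. q ^ (i * t)) + q ^ ((t + r + 1) div 2) + 1 \<le> card (P - {{0}})"
      using r P(3) by (intro card_partition_ge[OF V _ \<open>r < t\<close>]) auto
    also have "\<dots> \<le> y"
      using P finite_subspace_partition[OF P(2) fin] by (auto intro: card_mono)
    finally show "q ^ (t + r) * (\<Sum>i<j. q ^ (i * t)) + q ^ ((t + r + 1) div 2) + 1 \<le> y" .
  next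
    show "q ^ (t + r) * (\<Sum>i<j. q ^ (i * t)) + q ^ ((t + r + 1) div 2) + 1 \<in>
        {card P | P. subspace_partition scale V P \<and> (\<exists>U\<in>P. dim U = t) \<and> (\<forall>U\<in>P. dim U \<le> t)}"
      using minimal_partition_exists[OF V _ \<open>r < t\<close> j(2)] r by (smt (verit) less_eq_Suc_le One_nat_def mem_Collect_eq)
  qed
  moreover have "nat \<lceil>real (t + r) / 2\<rceil> = (t + r + 1) div 2"
  proof -
    define h where "h = (t + r + 1) div 2"
    then have "2 * h \<le> t + r + 1" "t + r \<le> 2 * h" by linarith+
    then have "real (2 * h) \<le> real (t + r + 1)" "real (t + r) \<le> real (2 * h)"
      by (simp_all only: of_nat_le_iff)
    then have "\<lceil>real (t + r) / 2\<rceil> = int h"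
      by (intro ceiling_unique) simp_all
    then show ?thesis by (simp add: h_def)
  qed
  ultimately show ?thesis unfolding sum_eq by simp
qed

end
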